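(* Assume the input space $\mathcal{X}$ is finite, let $\mathcal{D}$ be a distribution over $\mathcal{X}\times\{0,1\}$, and let $G(\mathcal{D},\mathcal{X})$ be the directed capacitated graph defined in the context. If $(S,\bar S)$ is a minimum $s$-$t$ cut of $G(\mathcal{D},\mathcal{X})$, where $S$ is the side containing $s$, then the classifier $f^*:\mathcal{X}\to\{0,1\}$ given by $f^*(x)=1$ if $x\in\bar S$ and $f^*(x)=0$ otherwise satisfies $$\ell_{\mathcal{D}}(f^* )=\min_{f}\ \ell_{\mathcal{D}}(f),$$ where the minimum is over all classifiers $f:\mathcal{X}\to\{0,1\}$.
   Context: There are $k$ features, indexed by $F=[k]=\{1,\dots,k\}$. Each data point $x\in\mathcal{X}$ has for each $i\in[k]$ a feature value $x_i$, where $x_i=*$ means that $x$ does not have feature $i$; a data point is determined by its feature values. For $S\subseteq[k]$, $x|_S$ is defined by $(x|_S)_i=x_i$ if $i\in S$ and $(x|_S)_i=*$ otherwise. For $x,x'\in\mathcal{X}$ write $x\to x'$ if there is $S\subseteq[k]$ with $x|_S=x'$ (an agent with true data point $x$ can report $x'$ by withholding features). A classifier is a function $f:\mathcal{X}\to\{0,1\}$. Agents prefer label $1$ and best-respond, so the loss of a classifier is $$\ell_{\mathcal{D}}(f)=\Pr_{(x,y)\sim\mathcal{D}}\Big[y\neq\max_{x'\in\mathcal{X}:\,x\to x'}f(x')\Big].$$ For $x\in\mathcal{X}$ let $\mathcal{D}^+(x)=\Pr_{(x',y')\sim\mathcal{D}}[x'=x\wedge y'=1]$ and $\mathcal{D}^-(x)=\Pr_{(x',y')\sim\mathcal{D}}[x'=x\wedge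 y'=0]$. The graph $G(\mathcal{D},\mathcal{X})$ has vertex set $\mathcal{X}\cup\{s,t\}$ and the following edges with capacities $u$: for each $x\in\mathcal{X}$, edges $(s,x)$ and $(x,t)$ with $u(s,x)=\mathcal{D}^-(x)$ and $u(x,t)=\mathcal{D}^+(x)$; and for all $x,x'\in\mathcal{X}$ with $x\to x'$, an edge $(x,x')$ with $u(x,x')=\infty$. The capacity of an $s$-$t$ cut $(S,\bar S)$ (with $s\in S$, $t\in\bar S$) is the total capacity of edges going from $S$ to $\bar S$. *)

theory Defs
  imports "HOL-Probability.Probability" "Graph_Theory.Pair_Digraph"
begin

text \<open>
  A data point over the features \<open>{1..k}\<close> is a partial map whose domain is the set of features
  it has, so \<open>None\<close> plays the role of \<open>*\<close> and \<open>x |` S\<close> is the restriction of \<open>x\<close> to \<open>S\<close>.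
  All features share one value type; this is no loss, as it may be a sum type.
\<close>

type_synonym 'v datapt = "nat \<rightharpoonup> 'v"

definition datapts :: "nat \<Rightarrow> 'v datapt set" where
  "datapts k = {x. dom x \<subseteq> {1..k}}"

definition can_report :: "nat \<Rightarrow> 'v datapt \<Rightarrow> 'v datapt \<Rightarrow> bool" where
  "can_report k x x' \<longleftrightarrow> (\<exists>S\<subseteq>{1..k}. x |` S = x')"

text \<open>
  Labels are the naturals 0 and 1. Classifiers are taken extensional, so that there is exactly
  one function for each map from \<open>X\<close> to \<open>{0, 1}\<close> and finitely many of them for finite \<open>X\<close>.
\<close>

definition classifiers :: "'v datapt set \<Rightarrow> ('v datapt \<Rightarrow> nat) set" where
  "classifiers X = X \<rightarrow>\<^sub>E {0, 1}"

definition loss ::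
  "nat \<Rightarrow> 'v datapt set \<Rightarrow> ('v datapt \<times> nat) pmf \<Rightarrow> ('v datapt \<Rightarrow> nat) \<Rightarrow> real" where
  "loss k X D f =
     measure_pmf.prob D {(x, y). y \<noteq> Max (f ` {x' \<in> X. can_report k x x'})}"

definition mass_pos :: "('v datapt \<times> nat) pmf \<Rightarrow> 'v datapt \<Rightarrow> real" where
  "mass_pos D x = measure_pmf.prob D {(x', y'). x' = x \<and> y' = 1}"

definition mass_neg :: "('v datapt \<times> nat) pmf \<Rightarrow> 'v datapt \<Rightarrow> real" where
  "mass_neg D x = measure_pmf.prob D {(x', y'). x' = x \<and> y' = 0}"

definition st_cut :: "'a pair_pre_digraph \<Rightarrow> 'a \<Rightarrow> 'a \<Rightarrow> 'a set \<Rightarrow> 'a set \<Rightarrow> bool" where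
  "st_cut G s t S T \<longleftrightarrow> S \<union> T = pverts G \<and> S \<inter> T = {} \<and> s \<in> S \<and> t \<in> T"

definition cut_capacity ::
  "'a pair_pre_digraph \<Rightarrow> ('a \<times> 'a \<Rightarrow> ennreal) \<Rightarrow> 'a set \<Rightarrow> 'a set \<Rightarrow> ennreal" where
  "cut_capacity G u S T = (\<Sum>e\<in>{e \<in> parcs G. fst e \<in> S \<and> snd e \<in> T}. u e)"

definition min_st_cut ::
  "'a pair_pre_digraph \<Rightarrow> ('a \<times> 'a \<Rightarrow> ennreal) \<Rightarrow> 'a \<Rightarrow> 'a \<Rightarrow> 'a set \<Rightarrow> 'a set \<Rightarrow> bool" where
  "min_st_cut G u s t S T \<longleftrightarrow>
     st_cut G s t S T \<and>
     (\<forall>S' T'. st_cut G s t S' T' \<longrightarrow> cut_capacity G u S T \<le> cut_capacity G u S' T')"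

datatype 'a vertex = Source | Sink | Point 'a

definition report_graph :: "nat \<Rightarrow> 'v datapt set \<Rightarrow> 'v datapt vertex pair_pre_digraph" where
  "report_graph k X =
     \<lparr> pverts = {Source, Sink} \<union> Point ` X,
       parcs = {(Source, Point x) | x. x \<in> X} \<union>
               {(Point x, Sink) | x. x \<in> X} \<union>
               {(Point x, Point x') | x x'. x \<in> X \<and> x' \<in> X \<and> can_report k x x'} \<rparr>"

text \<open>
  The last equation covers only pairs that are not edges of the graph, so its value is irrelevant.
\<close>

fun report_capacity ::
  "('v datapt \<times> nat) pmf \<Rightarrow> 'v datapt vertex \<times> 'v datapt vertex \<Rightarrow> ennreal" where
  "report_capacity D (Source, Point x) = ennreal (mass_neg D x)"
| "report_capacity D (Point x, Sink) = ennreal (mass_pos D x)"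
| "report_capacity D (Point x, Point x') = \<infinity>"
| "report_capacity D _ = 0"

definition cut_classifier :: "'v datapt set \<Rightarrow> 'v datapt vertex set \<Rightarrow> 'v datapt \<Rightarrow> nat" where
  "cut_classifier X T = (\<lambda>x\<in>X. if Point x \<in> T then 1 else 0)"

end

theory Submission
  imports Defs
begin

text \<open>
  A cut of finite capacity contains no reporting edge, so its sink side is closed under
  \<open>x \<rightarrow> x'\<close> read backwards. Then no agent gains by misreporting to the classifier of the cut,
  and its loss is the capacity of the cut. Conversely, for any classifier \<open>f\<close> the points that
  can obtain label 1 under \<open>f\<close> form, by transitivity of \<open>\<rightarrow>\<close>, such a closed sink side, and the
  resulting cut has capacity \<open>loss f\<close>. Hence minimum cuts yield minimum loss.
\<close>

definition obtained_label :: "nat \<Rightarrow> 'v datapt set \<Rightarrow> ('v datapt \<Rightarrow> nat) \<Rightarrow> 'v datapt \<Rightarrow> nat" where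
  "obtained_label k X f x = Max (f ` {x' \<in> X. can_report k x x'})"

definition report_closed :: "nat \<Rightarrow> 'v datapt set \<Rightarrow> 'v datapt vertex set \<Rightarrow> bool" where
  "report_closed k X T \<longleftrightarrow>
     (\<forall>x\<in>X. \<forall>x'\<in>X. can_report k x x' \<longrightarrow> Point x' \<in> T \<longrightarrow> Point x \<in> T)"

lemma can_report_refl: "x \<in> datapts k \<Longrightarrow> can_report k x x"
  unfolding can_report_def datapts_def
  by (intro exI[of _ "dom x"]) (simp add: restrict_map_def fun_eq_iff domIff)

text \<open>Withholding features twice leaves exactly the features in the intersection of the two
  retained sets.\<close>

lemma can_report_trans:
  assumes "can_report k x y" "can_report k y z"
  shows "can_report k x z"
proof -
  obtain A B where "A \<subseteq> {1..k}" "x |` A = y" "y |` B = z"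
    using assms unfolding can_report_def by blast
  then have "A \<inter> B \<subseteq> {1..k}" "x |` (A \<inter> B) = z"
    by auto
  then show ?thesis
    unfolding can_report_def by blast
qed

text \<open>\<open>Max\<close> is meaningful here because the reachable labels form a finite subset
  of \<open>{0, 1}\<close> that is nonempty: every point can report itself.\<close>

lemma obtained_label_eq_1_iff:
  assumes "finite X" "X \<subseteq> datapts k" "f \<in> classifiers X" "x \<in> X"
  shows "obtained_label k X f x = 1 \<longleftrightarrow> (\<exists>x'\<in>X. can_report k x x' \<and> f x' = 1)"
    and "obtained_label k X f x \<in> {0, 1}"
proof -
  let ?R = "{x' \<in> X. can_report k x x'}"
  have fin: "finite (f ` ?R)" and ne: "f ` ?R \<noteq> {}"
    using assms can_report_refl by auto
  have sub: "f ` ?R \<subseteq> {0, 1}"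
    using assms(3) unfolding classifiers_def by (auto simp: PiE_iff)
  have "Max (f ` ?R) \<in> f ` ?R"
    using fin ne by (rule Max_in)
  then show "obtained_label k X f x \<in> {0, 1}"
    unfolding obtained_label_def using sub by blast
  have "Max (f ` ?R) = 1 \<longleftrightarrow> 1 \<in> f ` ?R"
    using sub fin ne by (subst Max_eq_iff) auto
  then show "obtained_label k X f x = 1 \<longleftrightarrow> (\<exists>x'\<in>X. can_report k x x' \<and> f x' = 1)"
    unfolding obtained_label_def by force
qed

text \<open>Each point of \<open>X\<close> is misclassified with exactly one of its two labels, so
  the loss splits into one atom of \<open>D\<close> per point.\<close>

lemma loss_eq_sum:
  assumes "finite X" "X \<subseteq> datapts k" "f \<in> classifiers X" "set_pmf D \<subseteq> X \<times> {0, 1}"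
  shows "loss k X D f =
    (\<Sum>x\<in>X. if obtained_label k X f x = 1 then mass_neg D x else mass_pos D x)"
proof -
  let ?g = "obtained_label k X f"
  have g: "?g x \<in> {0, 1}" if "x \<in> X" for x
    using obtained_label_eq_1_iff(2) assms that by blast
  have mass: "mass_pos D x = pmf D (x, 1)" "mass_neg D x = pmf D (x, 0)" for x
    unfolding mass_pos_def mass_neg_def pmf.rep_eq
    by (auto intro!: arg_cong[where f = "measure (measure_pmf D)"])
  have "loss k X D f = measure_pmf.prob D ({(x, y). y \<noteq> ?g x} \<inter> set_pmf D)"
    unfolding loss_def obtained_label_def by (simp add: measure_Int_set_pmf)
  \<comment> \<open>As \<open>?g x\<close> is 0 or 1, \<open>1 - ?g x\<close> is the opposite label.
    Intersecting with the support discards pairs whose point is outside \<open>X\<close> or whose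
    label is neither 0 nor 1.\<close>
  also have "{(x, y). y \<noteq> ?g x} \<inter> set_pmf D = (\<lambda>x. (x, 1 - ?g x)) ` X \<inter> set_pmf D"
    using assms(4) g by fastforce
  also have "measure_pmf.prob D \<dots> = measure_pmf.prob D ((\<lambda>x. (x, 1 - ?g x)) ` X)"
    by (rule measure_Int_set_pmf)
  also have "\<dots> = (\<Sum>x\<in>X. pmf D (x, 1 - ?g x))"
    using assms(1) by (simp add: measure_measure_pmf_finite sum.reindex inj_on_def)
  also have "\<dots> = (\<Sum>x\<in>X. if ?g x = 1 then mass_neg D x else mass_pos D x)"
    using g by (intro sum.cong) (fastforce simp: mass)+
  finally show ?thesis .
qed

text \<open>No reporting edge crosses the cut, and each point contributes exactly one crossing edge:
  the one from \<open>Source\<close> if it lies in \<open>T\<close>, the one to \<open>Sink\<close>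
  otherwise. The map \<open>?e\<close> picks this edge.\<close>

lemma cut_capacity_report_closed:
  assumes "finite X" "st_cut (report_graph k X) Source Sink S T" "report_closed k X T"
  shows "cut_capacity (report_graph k X) (report_capacity D) S T =
    ennreal (\<Sum>x\<in>X. if Point x \<in> T then mass_neg D x else mass_pos D x)"
proof -
  let ?e = "\<lambda>x. if Point x \<in> T then (Source, Point x) else (Point x, Sink)"
  have side: "Point x \<in> S \<longleftrightarrow> Point x \<notin> T" if "x \<in> X" for x
    using assms(2) that unfolding st_cut_def report_graph_def by auto
  have st: "Source \<in> S" "Sink \<in> T" "Source \<notin> T" "Sink \<notin> S"
    using assms(2) unfolding st_cut_def by auto
  have "{e \<in> parcs (report_graph k X). fst e \<in> S \<and> snd e \<in> T} = ?e ` X"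
    using assms(3) side st unfolding report_graph_def report_closed_def
    by (auto simp: image_iff)
  moreover have "inj_on ?e X"
    by (auto simp: inj_on_def split: if_splits)
  ultimately have "cut_capacity (report_graph k X) (report_capacity D) S T =
      (\<Sum>x\<in>X. report_capacity D (?e x))"
    unfolding cut_capacity_def by (simp only: sum.reindex comp_def)
  also have "\<dots> = (\<Sum>x\<in>X. ennreal (if Point x \<in> T then mass_neg D x else mass_pos D x))"
    by (intro sum.cong) auto
  also have "\<dots> = ennreal (\<Sum>x\<in>X. if Point x \<in> T then mass_neg D x else mass_pos D x)"
    by (rule sum_ennreal) (simp add: mass_neg_def mass_pos_def)
  finally show ?thesis .
qed

lemma cut_capacity_not_report_closed:
  assumes "finite X" "st_cut (report_graph k X) Source Sink S T" "\<not> report_closed k X T"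
  shows "cut_capacity (report_graph k X) (report_capacity D) S T = \<infinity>"
proof -
  let ?C = "{e \<in> parcs (report_graph k X). fst e \<in> S \<and> snd e \<in> T}"
  obtain x x' where x: "x \<in> X" "x' \<in> X" "can_report k x x'" "Point x' \<in> T" "Point x \<notin> T"
    using assms(3) unfolding report_closed_def by blast
  then have "Point x \<in> S"
    using assms(2) unfolding st_cut_def report_graph_def by auto
  with x have "(Point x, Point x') \<in> ?C"
    unfolding report_graph_def by simp
  \<comment> \<open>Finiteness matters: a sum over an infinite set would be 0 by convention, hiding
    the infinite edge.\<close>
  moreover have "finite ?C"
  proof (rule finite_subset)
    let ?V = "{Source, Sink} \<union> Point ` X"
    show "?C \<subseteq> ?V \<times> ?V"
      unfolding report_graph_def by auto
    show "finite (?V \<times> ?V)"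
      using assms(1) by simp
  qed
  ultimately have "report_capacity D (Point x, Point x') \<le> sum (report_capacity D) ?C"
    by (intro member_le_sum) auto
  then show ?thesis
    unfolding cut_capacity_def by (simp add: top_unique)
qed

lemma cut_classifier_in_classifiers: "cut_classifier X T \<in> classifiers X"
  unfolding cut_classifier_def classifiers_def by auto

text \<open>Closedness rules out a gain by misreporting from outside \<open>T\<close>; a point in
  \<open>T\<close> gets label 1 by reporting itself.\<close>

lemma obtained_label_cut_classifier:
  assumes "finite X" "X \<subseteq> datapts k" "report_closed k X T" "x \<in> X"
  shows "obtained_label k X (cut_classifier X T) x = 1 \<longleftrightarrow> Point x \<in> T"
proof -
  have "can_report k x x"
    using assms(2,4) can_report_refl by blast
  then show ?thesis
    using assms(3,4)
    unfolding obtained_label_eq_1_iff(1)[OF assms(1,2) cut_classifier_in_classifiers assms(4)]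
    by (auto simp: cut_classifier_def report_closed_def)
qed

lemma obtain_cut_of_classifier:
  assumes "finite X" "X \<subseteq> datapts k" "f \<in> classifiers X" "set_pmf D \<subseteq> X \<times> {0, 1}"
  obtains S T where "st_cut (report_graph k X) Source Sink S T"
    and "cut_capacity (report_graph k X) (report_capacity D) S T = ennreal (loss k X D f)"
proof
  \<comment> \<open>Taking the points where \<open>f\<close> itself is 1 would not do, as that set
    need not be closed. Passing to the obtained label closes it, because two successive reports
    compose to one.\<close>
  let ?T = "insert Sink (Point ` {x \<in> X. obtained_label k X f x = 1})"
  let ?S = "pverts (report_graph k X) - ?T"
  show cut: "st_cut (report_graph k X) Source Sink ?S ?T"
    unfolding st_cut_def report_graph_def by auto
  have "report_closed k X ?T"
    using obtained_label_eq_1_iff(1)[OF assms(1-3)] can_report_trans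
    unfolding report_closed_def by auto blast
  from cut_capacity_report_closed[OF assms(1) cut this]
  show "cut_capacity (report_graph k X) (report_capacity D) ?S ?T = ennreal (loss k X D f)"
    unfolding loss_eq_sum[OF assms] by (auto intro!: arg_cong[where f = ennreal] sum.cong)
qed

theorem theorem1:
  fixes k :: nat and X :: "'v datapt set" and D :: "('v datapt \<times> nat) pmf"
    and S Sbar :: "'v datapt vertex set"
  assumes "X \<subseteq> datapts k"
    and "finite X"
    and "set_pmf D \<subseteq> X \<times> {0, 1}"
    and "min_st_cut (report_graph k X) (report_capacity D) Source Sink S Sbar"
  shows "cut_classifier X Sbar \<in> classifiers X \<and>
    loss k X D (cut_classifier X Sbar) = (MIN f\<in>classifiers X. loss k X D f)"
proof
  let ?cap = "cut_capacity (report_graph k X) (report_capacity D)"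
  let ?f = "cut_classifier X Sbar"
  show mem: "?f \<in> classifiers X"
    by (rule cut_classifier_in_classifiers)
  have cut: "st_cut (report_graph k X) Source Sink S Sbar"
    using assms(4) unfolding min_st_cut_def by blast
  have cap_le: "?cap S Sbar \<le> ennreal (loss k X D f)" if f: "f \<in> classifiers X" for f
  proof -
    obtain S' T' where "st_cut (report_graph k X) Source Sink S' T'"
      and "?cap S' T' = ennreal (loss k X D f)"
      using obtain_cut_of_classifier[OF assms(2,1) f assms(3)] .
    then show ?thesis
      using assms(4) unfolding min_st_cut_def by metis
  qed
  \<comment> \<open>The bound is applied to the classifier of the cut itself: its loss is a real
    number, so the capacity is finite and no reporting edge crosses.\<close>
  have closed: "report_closed k X Sbar"
    using cut_capacity_not_report_closed[OF assms(2) cut] cap_le[OF mem]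
    by (metis ennreal_neq_top infinity_ennreal_def neq_top_trans)
  have cap_eq: "?cap S Sbar = ennreal (loss k X D ?f)"
    unfolding cut_capacity_report_closed[OF assms(2) cut closed]
      loss_eq_sum[OF assms(2,1) mem assms(3)]
    using obtained_label_cut_classifier[OF assms(2,1) closed]
    by (auto intro!: arg_cong[where f = ennreal] sum.cong)
  \<comment> \<open>Since \<open>ennreal\<close> sends negative reals to 0, nonnegativity is what
    lets the comparison of capacities return to the reals.\<close>
  have nonneg: "0 \<le> loss k X D f" for f
    unfolding loss_def by simp
  have "finite (classifiers X)"
    unfolding classifiers_def using assms(2) by (intro finite_PiE) auto
  then show "loss k X D ?f = (MIN f\<in>classifiers X. loss k X D f)"
    using mem cap_le nonneg unfolding cap_eq by (intro Min_eqI[symmetric]) auto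
qed

end
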